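(* Let $(U,p)$ be a partial metric space such that $(U,\mathcal{T}[p])$ is a Hausdorff space. If $(U,\mathcal{T}[p])$ is compact, then it is metrizable.
   Context: Let $\mathbb{R}_+=[0,\infty)$. A partial metric on a nonempty set $U$ is a function $p:U\times U\to\mathbb{R}_+$ such that for all $x,y,z\in U$: (1) $x=y \Leftrightarrow p(x,x)=p(x,y)=p(y,y)$; (2) $p(x,x)\le p(y,x)$; (3) $p(x,y)=p(y,x)$; (4) $p(x,y)\le p(x,z)+p(z,y)-p(z,z)$. The pair $(U,p)$ is called a partial metric space. For $x\in U$ and $\varepsilon>0$ the open ball is $B(x,\varepsilon)=\{y\in U: p(x,y)<p(x,x)+\varepsilon\}$; the open balls form a basis of a topology on $U$ denoted $\mathcal{T}[p]$. A topological space is compact if every open cover has a finite subcover (no separation axiom is assumed). *)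

theory Defs
  imports "HOL-Analysis.Analysis"
begin

locale Partial_Metric_space =
  fixes U :: "'a set" and p :: "'a \<Rightarrow> 'a \<Rightarrow> real"
  assumes nonempty: "U \<noteq> {}"
    and nonneg: "\<And>x y. \<lbrakk>x \<in> U; y \<in> U\<rbrakk> \<Longrightarrow> 0 \<le> p x y"
    and eq_iff: "\<And>x y. \<lbrakk>x \<in> U; y \<in> U\<rbrakk> \<Longrightarrow> x = y \<longleftrightarrow> p x x = p x y \<and> p x y = p y y"
    and self_le: "\<And>x y. \<lbrakk>x \<in> U; y \<in> U\<rbrakk> \<Longrightarrow> p x x \<le> p y x"
    and commute: "\<And>x y. \<lbrakk>x \<in> U; y \<in> U\<rbrakk> \<Longrightarrow> p x y = p y x"
    and triangle: "\<And>x y z. \<lbrakk>x \<in> U; y \<in> U; z \<in> U\<rbrakk> \<Longrightarrow> p x y \<le> p x z + p z y - p z z"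
begin

definition pball :: "'a \<Rightarrow> real \<Rightarrow> 'a set" where
  "pball x \<epsilon> = {y \<in> U. p x y < p x x + \<epsilon>}"

definition ptopology :: "'a topology" where
  "ptopology = topology (arbitrary union_of (\<lambda>B. \<exists>x\<in>U. \<exists>\<epsilon>>0. B = pball x \<epsilon>))"

lemma centre_in_pball: "x \<in> U \<Longrightarrow> 0 < \<epsilon> \<Longrightarrow> x \<in> pball x \<epsilon>"
  by (simp add: pball_def)

lemma pball_nested:
  assumes "x \<in> U" "y \<in> pball x \<epsilon>"
  shows "\<exists>\<delta>>0. pball y \<delta> \<subseteq> pball x \<epsilon>"
proof (intro exI conjI)
  show "0 < p x x + \<epsilon> - p x y"
    using assms by (simp add: pball_def)
  show "pball y (p x x + \<epsilon> - p x y) \<subseteq> pball x \<epsilon>"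
  proof
    fix z assume z: "z \<in> pball y (p x x + \<epsilon> - p x y)"
    then have "p x z \<le> p x y + p y z - p y y"
      using assms triangle by (simp add: pball_def)
    then show "z \<in> pball x \<epsilon>"
      using z by (simp add: pball_def)
  qed
qed

lemma pball_mono: "\<delta> \<le> \<epsilon> \<Longrightarrow> pball x \<delta> \<subseteq> pball x \<epsilon>"
  by (auto simp: pball_def)

text \<open>
  The open balls satisfy the basis condition, so the topology above is not a junk value: its open
  sets are exactly the unions of open balls.
\<close>

lemma istopology_pballs:
  "istopology (arbitrary union_of (\<lambda>B. \<exists>x\<in>U. \<exists>\<epsilon>>0. B = pball x \<epsilon>))"
  unfolding istopology_base_eq
proof (intro allI impI)
  fix S T
  assume ST: "(\<exists>x\<in>U. \<exists>\<epsilon>>0. S = pball x \<epsilon>) \<and> (\<exists>x\<in>U. \<exists>\<epsilon>>0. T = pball x \<epsilon>)"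
  have "\<exists>B. (\<exists>x\<in>U. \<exists>\<epsilon>>0. B = pball x \<epsilon>) \<and> z \<in> B \<and> B \<subseteq> S \<inter> T" if z: "z \<in> S \<inter> T" for z
  proof -
    have zU: "z \<in> U"
      using ST z by (auto simp: pball_def)
    obtain a where a: "a > 0" "pball z a \<subseteq> S"
      using ST z pball_nested by blast
    obtain b where b: "b > 0" "pball z b \<subseteq> T"
      using ST z pball_nested by blast
    have "pball z (min a b) \<subseteq> S \<inter> T"
      using a b pball_mono[of "min a b" a z] pball_mono[of "min a b" b z] by auto
    moreover have "z \<in> pball z (min a b)" "0 < min a b"
      using zU a b by (auto intro: centre_in_pball)
    ultimately show ?thesis
      using zU by blast
  qed
  then show "(arbitrary union_of (\<lambda>B. \<exists>x\<in>U. \<exists>\<epsilon>>0. B = pball x \<epsilon>)) (S \<inter> T)"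
    unfolding arbitrary_union_of_alt by blast
qed

lemma openin_ptopology:
  "openin ptopology = arbitrary union_of (\<lambda>B. \<exists>x\<in>U. \<exists>\<epsilon>>0. B = pball x \<epsilon>)"
  by (simp add: ptopology_def topology_inverse' istopology_pballs)

lemma topspace_ptopology: "topspace ptopology = U"
proof -
  let ?P = "\<lambda>B. \<exists>x\<in>U. \<exists>\<epsilon>>0. B = pball x \<epsilon>"
  have *: "\<And>B. ?P B \<Longrightarrow> openin ptopology B"
    "\<And>x. x \<in> topspace ptopology \<Longrightarrow> \<exists>B. ?P B \<and> x \<in> B"
    using openin_ptopology openin_topspace[of ptopology]
    unfolding openin_topology_base_unique by blast+
  show ?thesis
  proof
    show "topspace ptopology \<subseteq> U"
      using *(2) by (fastforce simp: pball_def)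
    show "U \<subseteq> topspace ptopology"
    proof
      fix x assume x: "x \<in> U"
      then have "openin ptopology (pball x 1)"
        using *(1) zero_less_one by blast
      then show "x \<in> topspace ptopology"
        using centre_in_pball[OF x, of 1] openin_subset by auto
    qed
  qed
qed

end

end

theory Submission
  imports Defs
begin

text \<open>
  Write \<open>q x y = p x y - p x x\<close>, so that \<open>pball x \<epsilon>\<close> is the \<open>q\<close>-ball of radius \<open>\<epsilon>\<close>. The function \<open>q\<close>
  is a quasi-metric: it obeys the triangle inequality but is not symmetric. The asymmetry is
  controlled by the weight \<open>p x x\<close>, because \<open>q y x = q x y + (p x x - p y y)\<close>: among points \<open>x\<close> that
  weigh less than \<open>p y y + \<epsilon>\<close>, closeness of \<open>y\<close> to \<open>x\<close> implies closeness of \<open>x\<close> to \<open>y\<close>. Hence all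
  balls \<open>pball x \<epsilon>\<close> that contain \<open>y\<close> and have such a centre lie in \<open>pball y (3 * \<epsilon>)\<close>
  (\<open>pball_subset_pball_of_light_centre\<close>).

  This makes the space second countable as soon as every open set is Lindelof. For rational \<open>r\<close>, the
  set \<open>W r\<close> of points of weight less than \<open>r\<close> is open, because the weight is upper semicontinuous. So
  \<open>W r\<close> is covered by countably many balls of radius \<open>1/n\<close> with centre in \<open>W r\<close>. Letting \<open>n\<close> and \<open>r\<close>
  vary gives a countable base: for a given point \<open>y\<close>, take \<open>r\<close> just above its weight.

  In a compact space, open sets are Lindelof if they are \<open>F\<^sub>\<sigma>\<close>, since they are then \<open>\<sigma>\<close>-compact.
  The open set \<open>U - C\<close> is the union of the closed sets that remain when all balls of radius \<open>1/n\<close>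
  centred in \<open>C\<close> are removed, provided that \<open>q x y\<close> is bounded away from \<open>0\<close> for \<open>x\<close> in \<open>C\<close> whenever
  \<open>y\<close> is outside \<open>C\<close>. It is, since \<open>C\<close> is compact and \<open>q x y\<close> is positive (by separation) and lower
  semicontinuous in \<open>x\<close>.

  Finally, Urysohn's argument embeds a second countable compact Hausdorff space into the metric
  space of real sequences.
\<close>

section \<open>Urysohn metrization of compact spaces\<close>

text \<open>
  Countably many continuous real functions are the coordinates of a continuous map into a metrizable
  space. If they separate points, that map is injective, and compactness makes it an embedding.
\<close>

lemma metrizable_space_if_countable_separating_functions:
  fixes f :: "nat \<Rightarrow> 'a \<Rightarrow> real"
  assumes "compact_space X"
    and cont: "\<And>n. continuous_map X euclideanreal (f n)"
    and sep: "\<And>x y. \<lbrakk>x \<in> topspace X; y \<in> topspace X; x \<noteq> y\<rbrakk> \<Longrightarrow> \<exists>n. f n x \<noteq> f n y"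
  shows "metrizable_space X"
proof -
  let ?g = "\<lambda>x n. f n x"
  have "continuous_map X (euclidean :: (nat \<Rightarrow> real) topology) ?g"
    using cont by (simp add: continuous_map_componentwise_UNIV flip: euclidean_product_topology)
  moreover have "inj_on ?g (topspace X)"
    using sep by (fastforce simp: inj_on_def fun_eq_iff)
  ultimately have "embedding_map X (euclidean :: (nat \<Rightarrow> real) topology) ?g"
    using \<open>compact_space X\<close> by (simp add: continuous_imp_embedding_map)
  then have "X homeomorphic_space top_of_set (?g ` topspace X)"
    using embedding_map_imp_homeomorphic_space by blast
  then show ?thesis
    using homeomorphic_metrizable_space metrizable_space_subtopology metrizable_space_euclidean
    by blast
qed

lemma metrizable_space_compact_Hausdorff_second_countable:
  assumes "compact_space X" "Hausdorff_space X" "second_countable X"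
  shows "metrizable_space X"
proof -
  obtain \<B> where \<B>: "countable \<B>" "\<And>V. V \<in> \<B> \<Longrightarrow> openin X V"
    and base: "\<And>S x. \<lbrakk>openin X S; x \<in> S\<rbrakk> \<Longrightarrow> \<exists>V\<in>\<B>. x \<in> V \<and> V \<subseteq> S"
    using \<open>second_countable X\<close> unfolding second_countable_def by metis
  have normal: "normal_space X" and regular: "regular_space X"
    using assms compact_Hausdorff_or_regular_imp_normal_space compact_Hausdorff_imp_regular_space
    by blast+
  \<comment> \<open>Each admissible pair of basic sets gets one Urysohn function, so countably many suffice.\<close>
  define P where "P = {(V, W). V \<in> \<B> \<and> W \<in> \<B> \<and> X closure_of V \<subseteq> W}"
  have "countable P"
    using countable_subset[of P "\<B> \<times> \<B>"] \<B>(1) by (auto simp: P_def)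
  have "\<exists>g. continuous_map X euclideanreal g \<and> g ` (X closure_of V) \<subseteq> {0}
            \<and> g ` (topspace X - W) \<subseteq> {1}"
    if "(V, W) \<in> P" for V W
  proof -
    have "disjnt (X closure_of V) (topspace X - W)" "openin X W"
      using that \<B>(2) by (auto simp: P_def disjnt_def)
    then show ?thesis
      using Urysohn_lemma_alt[OF normal closedin_closure_of closedin_diff[OF closedin_topspace]]
      by metis
  qed
  then have "\<forall>B. \<exists>g. B \<in> P \<longrightarrow> continuous_map X euclideanreal g
      \<and> g ` (X closure_of fst B) \<subseteq> {0} \<and> g ` (topspace X - snd B) \<subseteq> {1}"
    by (metis prod.collapse)
  then obtain u where u: "\<And>B. B \<in> P \<Longrightarrow> continuous_map X euclideanreal (u B)"
    "\<And>B. B \<in> P \<Longrightarrow> u B ` (X closure_of fst B) \<subseteq> {0}"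
    "\<And>B. B \<in> P \<Longrightarrow> u B ` (topspace X - snd B) \<subseteq> {1}"
    by metis
  have separated: "\<exists>B\<in>P. u B x \<noteq> u B y"
    if x: "x \<in> topspace X" and y: "y \<in> topspace X" and "x \<noteq> y" for x y
  proof -
    obtain S where S: "openin X S" "x \<in> S" "y \<notin> S"
      using Hausdorff_imp_t1_space[OF \<open>Hausdorff_space X\<close>] x y \<open>x \<noteq> y\<close>
      unfolding t1_space_def by blast
    obtain W where W: "W \<in> \<B>" "x \<in> W" "y \<notin> W"
      using base[OF S(1,2)] S(3) by blast
    obtain T K where T: "openin X T" "closedin X K" "x \<in> T" "T \<subseteq> K" "K \<subseteq> W"
      using regular \<B>(2)[OF W(1)] W(2)
      unfolding neighbourhood_base_of_closedin[symmetric] neighbourhood_base_of by meson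
    obtain V where V: "V \<in> \<B>" "x \<in> V" "V \<subseteq> T"
      using base[OF T(1,3)] by blast
    have "X closure_of V \<subseteq> K"
      using V(3) T(2,4) by (intro closure_of_minimal) auto
    then have "X closure_of V \<subseteq> W"
      using T(5) by (rule subset_trans)
    then have "(V, W) \<in> P"
      using V W by (simp add: P_def)
    moreover have "u (V, W) x = 0"
      using u(2)[OF \<open>(V, W) \<in> P\<close>] closure_of_subset[OF openin_subset[OF \<B>(2)[OF V(1)]]] V(2)
      by auto
    moreover have "u (V, W) y = 1"
      using u(3)[OF \<open>(V, W) \<in> P\<close>] y W(3) by auto
    ultimately show ?thesis
      by force
  qed
  show ?thesis
  proof (cases "P = {}")
    case True
    \<comment> \<open>Then there are no two points to separate.\<close>
    then show ?thesis
      using separated assms(1)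
        metrizable_space_if_countable_separating_functions[where f = "\<lambda>_ _. 0"] by fastforce
  next
    case False
    then have "range (from_nat_into P) = P"
      using \<open>countable P\<close> by (simp add: range_from_nat_into)
    then have "\<And>n. from_nat_into P n \<in> P" and "\<And>B. B \<in> P \<Longrightarrow> \<exists>n. B = from_nat_into P n"
      by auto
    then show ?thesis
      using u(1) separated
      by (intro metrizable_space_if_countable_separating_functions
            [OF assms(1), where f = "\<lambda>n. u (from_nat_into P n)"]) metis+
  qed
qed

section \<open>Second countability of compact partial metric spaces\<close>

context Partial_Metric_space
begin

lemma openin_pball:
  assumes "x \<in> U" "0 < \<epsilon>"
  shows "openin ptopology (pball x \<epsilon>)"
  unfolding openin_ptopology using assms by (blast intro: arbitrary_union_of_inc)

lemma openin_ptopology_iff: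
  "openin ptopology S \<longleftrightarrow> S \<subseteq> U \<and> (\<forall>x\<in>S. \<exists>\<epsilon>>0. pball x \<epsilon> \<subseteq> S)"
proof
  assume S: "openin ptopology S"
  have "\<exists>\<epsilon>>0. pball x \<epsilon> \<subseteq> S" if "x \<in> S" for x
  proof -
    obtain z \<delta> where "z \<in> U" "x \<in> pball z \<delta>" "pball z \<delta> \<subseteq> S"
      using S \<open>x \<in> S\<close> unfolding openin_ptopology arbitrary_union_of_alt by blast
    then show ?thesis
      using pball_nested by blast
  qed
  then show "S \<subseteq> U \<and> (\<forall>x\<in>S. \<exists>\<epsilon>>0. pball x \<epsilon> \<subseteq> S)"
    using openin_subset[OF S] topspace_ptopology by blast
next
  assume "S \<subseteq> U \<and> (\<forall>x\<in>S. \<exists>\<epsilon>>0. pball x \<epsilon> \<subseteq> S)"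
  then show "openin ptopology S"
    by (subst openin_subopen) (meson centre_in_pball openin_pball subsetD)
qed

lemma self_less_if_t1:
  assumes "t1_space ptopology" "x \<in> U" "y \<in> U" "x \<noteq> y"
  shows "p x x < p x y"
proof -
  obtain S where S: "openin ptopology S" "x \<in> S" "y \<notin> S"
    using assms unfolding t1_space_def topspace_ptopology by blast
  then obtain \<epsilon> where "\<epsilon> > 0" "pball x \<epsilon> \<subseteq> S"
    unfolding openin_ptopology_iff by blast
  then show ?thesis
    using S(3) assms(3) by (auto simp: pball_def)
qed

text \<open>
  Lower semicontinuity of \<open>p x y - p x x\<close> in \<open>x\<close>: on the ball around \<open>x\<close> with half this value as
  radius, the function is at least that radius. Finitely many such balls cover \<open>C\<close>.
\<close>

lemma compactin_imp_uniformly_outside_pballs: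
  assumes "t1_space ptopology" "compactin ptopology C" "y \<in> U" "y \<notin> C"
  shows "\<exists>\<epsilon>>0. \<forall>x\<in>C. y \<notin> pball x \<epsilon>"
proof -
  define e where "e x = (p x y - p x x) / 2" for x
  have CU: "C \<subseteq> U"
    using assms(2) compactin_subset_topspace topspace_ptopology by blast
  have e: "0 < e x" if "x \<in> C" for x
    using self_less_if_t1[OF assms(1), of x y] assms(3,4) CU that by (auto simp: e_def)
  have "\<exists>\<F>. finite \<F> \<and> \<F> \<subseteq> (\<lambda>x. pball x (e x)) ` C \<and> C \<subseteq> \<Union>\<F>"
  proof (rule compactinD[OF assms(2)])
    show "openin ptopology B" if "B \<in> (\<lambda>x. pball x (e x)) ` C" for B
      using that CU e openin_pball by blast
    show "C \<subseteq> \<Union>((\<lambda>x. pball x (e x)) ` C)"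
      using CU e centre_in_pball by blast
  qed
  then obtain \<F> where \<F>: "finite \<F>" "\<F> \<subseteq> (\<lambda>x. pball x (e x)) ` C" "C \<subseteq> \<Union>\<F>"
    by blast
  then obtain D where D: "finite D" "D \<subseteq> C" "C \<subseteq> (\<Union>x\<in>D. pball x (e x))"
    using finite_subset_image[OF \<F>(1,2)] by blast
  \<comment> \<open>The entry \<open>1\<close> keeps the minimum defined when \<open>C\<close> is empty.\<close>
  define \<epsilon> where "\<epsilon> = Min (insert 1 (e ` D))"
  have "0 < \<epsilon>"
    using D e by (auto simp: \<epsilon>_def)
  moreover have "y \<notin> pball x \<epsilon>" if x: "x \<in> C" for x
  proof -
    obtain z where z: "z \<in> D" "x \<in> pball z (e z)"
      using D x by blast
    have "p z y \<le> p z x + p x y - p x x" "p z x < p z z + e z"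
      using triangle[of z y x] z D(2) CU x assms(3) by (auto simp: pball_def)
    then have "e z \<le> p x y - p x x"
      unfolding e_def by argo
    moreover have "\<epsilon> \<le> e z"
      using D(1) z(1) by (simp add: \<epsilon>_def)
    ultimately show ?thesis
      by (simp add: pball_def)
  qed
  ultimately show ?thesis
    by blast
qed

lemma compact_t1_open_imp_fsigma:
  assumes "compact_space ptopology" "t1_space ptopology" "openin ptopology S"
  shows "fsigma_in ptopology S"
proof -
  define C where "C = U - S"
  define K where "K n = U - (\<Union>x\<in>C. pball x (inverse (real (Suc n))))" for n
  have "closedin ptopology C"
    using closedin_diff[OF closedin_topspace assms(3)] by (simp add: C_def topspace_ptopology)
  then have "compactin ptopology C"
    using assms(1) closedin_compact_space by blast
  have "openin ptopology (\<Union>x\<in>C. pball x (inverse (real (Suc n))))" for n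
    by (intro openin_Union) (auto intro!: openin_pball simp: C_def)
  then have "closedin ptopology (K n)" for n
    using closedin_diff[OF closedin_topspace, of ptopology] by (simp add: K_def topspace_ptopology)
  moreover have "(\<Union>n. K n) = S"
  proof
    show "(\<Union>n. K n) \<subseteq> S"
    proof
      fix y assume "y \<in> (\<Union>n. K n)"
      then obtain n where n: "y \<in> K n"
        by blast
      then have "y \<notin> C"
        using centre_in_pball[of y "inverse (real (Suc n))"] by (auto simp: K_def)
      then show "y \<in> S"
        using n by (simp add: K_def C_def)
    qed
    show "S \<subseteq> (\<Union>n. K n)"
    proof
      fix y assume "y \<in> S"
      then have y: "y \<in> U" "y \<notin> C"
        using assms(3) openin_ptopology_iff by (auto simp: C_def)
      obtain \<epsilon> where \<epsilon>: "\<epsilon> > 0" "\<forall>x\<in>C. y \<notin> pball x \<epsilon>"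
        using compactin_imp_uniformly_outside_pballs[OF assms(2) \<open>compactin ptopology C\<close> y] by blast
      obtain n where n: "inverse (real (Suc n)) < \<epsilon>"
        using reals_Archimedean[OF \<epsilon>(1)] by blast
      then have "\<forall>x\<in>C. y \<notin> pball x (inverse (real (Suc n)))"
        using \<epsilon>(2) pball_mono[OF less_imp_le[OF n]] by blast
      then show "y \<in> (\<Union>n. K n)"
        using y by (auto simp: K_def)
    qed
  qed
  ultimately show ?thesis
    unfolding fsigma_in_def union_of_def by (intro exI[of _ "range K"]) auto
qed

lemma compact_t1_open_imp_Lindelof:
  assumes "compact_space ptopology" "t1_space ptopology" "openin ptopology S"
  shows "Lindelof_space (subtopology ptopology S)"
proof -
  obtain \<C> where "countable \<C>" "\<And>K. K \<in> \<C> \<Longrightarrow> closedin ptopology K" "\<Union>\<C> = S"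
    using compact_t1_open_imp_fsigma[OF assms] unfolding fsigma_in_def union_of_def by blast
  then show ?thesis
    using Lindelof_space_Union[of \<C> ptopology] assms(1)
    by (metis closedin_compact_space compact_imp_Lindelof_space compactin_subspace)
qed

lemma openin_light_points: "openin ptopology {x \<in> U. p x x < r}"
  unfolding openin_ptopology_iff
proof (intro conjI ballI)
  fix x assume x: "x \<in> {x \<in> U. p x x < r}"
  have "p z z < r" if "z \<in> pball x (r - p x x)" for z
    using that x self_le[of z x] by (auto simp: pball_def)
  then show "\<exists>\<epsilon>>0. pball x \<epsilon> \<subseteq> {x \<in> U. p x x < r}"
    using x by (intro exI[of _ "r - p x x"]) (auto simp: pball_def)
qed auto

text \<open>
  The upper bound on the weight of \<open>x\<close> turns closeness of \<open>y\<close> to \<open>x\<close> into closeness of \<open>x\<close> to \<open>y\<close>, as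
  \<open>p y x < p x x + \<epsilon> < p y y + 2 * \<epsilon>\<close>. The third \<open>\<epsilon>\<close> is the radius of the ball around \<open>x\<close>.
\<close>

lemma pball_subset_pball_of_light_centre:
  assumes "x \<in> U" "y \<in> pball x \<epsilon>" "p x x < p y y + \<epsilon>"
  shows "pball x \<epsilon> \<subseteq> pball y (3 * \<epsilon>)"
proof
  fix z assume "z \<in> pball x \<epsilon>"
  then show "z \<in> pball y (3 * \<epsilon>)"
    using assms triangle[of y z x] commute[of x y] by (simp add: pball_def)
qed

lemma countable_pball_cover_of_light_points:
  assumes "compact_space ptopology" "t1_space ptopology" "0 < \<epsilon>"
  shows "\<exists>D. countable D \<and> D \<subseteq> {x \<in> U. p x x < r} \<and> {x \<in> U. p x x < r} \<subseteq> (\<Union>x\<in>D. pball x \<epsilon>)"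
proof -
  let ?W = "{x \<in> U. p x x < r}"
  have "Lindelof_space (subtopology ptopology ?W)"
    using assms openin_light_points compact_t1_open_imp_Lindelof by blast
  moreover have "\<forall>B \<in> (\<lambda>x. pball x \<epsilon>) ` ?W. openin ptopology B"
    using assms(3) openin_pball by blast
  moreover have "?W \<subseteq> \<Union>((\<lambda>x. pball x \<epsilon>) ` ?W)"
    using assms(3) centre_in_pball by blast
  ultimately obtain \<V> where \<V>: "countable \<V>" "\<V> \<subseteq> (\<lambda>x. pball x \<epsilon>) ` ?W" "?W \<subseteq> \<Union>\<V>"
    using Lindelof_space_subtopology_subset[of ?W ptopology]
    unfolding topspace_ptopology by (metis (no_types, lifting) mem_Collect_eq subsetI)
  then obtain D where "countable D" "D \<subseteq> ?W" "\<V> = (\<lambda>x. pball x \<epsilon>) ` D"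
    using countable_subset_image[of \<V> "\<lambda>x. pball x \<epsilon>" ?W] by blast
  then show ?thesis
    using \<V>(3) by blast
qed

lemma second_countable_if_compact_t1:
  assumes "compact_space ptopology" "t1_space ptopology"
  shows "second_countable ptopology"
proof -
  define \<epsilon> where "\<epsilon> n = inverse (real (Suc n))" for n
  have \<epsilon>: "0 < \<epsilon> n" for n
    by (simp add: \<epsilon>_def)
  have "\<exists>D. \<forall>n r. countable (D n r) \<and> D n r \<subseteq> {x \<in> U. p x x < of_rat r}
      \<and> {x \<in> U. p x x < of_rat r} \<subseteq> (\<Union>x\<in>D n r. pball x (\<epsilon> n))"
    by (intro choice allI countable_pball_cover_of_light_points[OF assms \<epsilon>])
  then obtain D where "\<forall>n r. countable (D n r) \<and> D n r \<subseteq> {x \<in> U. p x x < of_rat r}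
      \<and> {x \<in> U. p x x < of_rat r} \<subseteq> (\<Union>x\<in>D n r. pball x (\<epsilon> n))"
    by (rule exE)
  then have D: "countable (D n r)" "D n r \<subseteq> {x \<in> U. p x x < of_rat r}"
    "{x \<in> U. p x x < of_rat r} \<subseteq> (\<Union>x\<in>D n r. pball x (\<epsilon> n))" for n r
    by blast+
  define \<B> where "\<B> = (\<Union>n. \<Union>r. (\<lambda>x. pball x (\<epsilon> n)) ` D n r)"
  have "countable \<B>"
    unfolding \<B>_def using D(1) by (intro countable_UN countable_image) auto
  moreover have "openin ptopology V" if "V \<in> \<B>" for V
  proof -
    obtain n r x where x: "x \<in> D n r" "V = pball x (\<epsilon> n)"
      using \<open>V \<in> \<B>\<close> unfolding \<B>_def by blast
    then have "x \<in> U"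
      using D(2)[where n = n and r = r] by auto
    then show ?thesis
      using x(2) \<epsilon> openin_pball by simp
  qed
  moreover have "\<exists>V\<in>\<B>. y \<in> V \<and> V \<subseteq> S" if S: "openin ptopology S" "y \<in> S" for S y
  proof -
    obtain \<delta> where \<delta>: "\<delta> > 0" "pball y \<delta> \<subseteq> S" and y: "y \<in> U"
      using S unfolding openin_ptopology_iff by blast
    obtain n where n: "\<epsilon> n < \<delta> / 3"
      using reals_Archimedean[of "\<delta> / 3"] \<delta>(1) by (auto simp: \<epsilon>_def)
    obtain r where r: "p y y < of_rat r" "of_rat r < p y y + \<epsilon> n"
      using of_rat_dense[of "p y y" "p y y + \<epsilon> n"] \<epsilon> by auto
    obtain x where x: "x \<in> D n r" "y \<in> pball x (\<epsilon> n)"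
      using D(3)[where n = n and r = r] y r(1) by blast
    have "x \<in> U" "p x x < p y y + \<epsilon> n"
      using D(2)[where n = n and r = r] x(1) r(2) by auto
    then have "pball x (\<epsilon> n) \<subseteq> pball y (3 * \<epsilon> n)"
      using pball_subset_pball_of_light_centre x(2) by blast
    also have "\<dots> \<subseteq> S"
      using \<delta>(2) n pball_mono[of "3 * \<epsilon> n" \<delta> y] by auto
    finally show ?thesis
      using x unfolding \<B>_def by blast
  qed
  ultimately show ?thesis
    unfolding second_countable_def by blast
qed

end

theorem corollary4p6:
  fixes U :: "'a set" and p :: "'a \<Rightarrow> 'a \<Rightarrow> real"
  assumes "Partial_Metric_space U p"
    and "Hausdorff_space (Partial_Metric_space.ptopology U p)"
    and "compact_space (Partial_Metric_space.ptopology U p)"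
  shows "metrizable_space (Partial_Metric_space.ptopology U p)"
  using assms Partial_Metric_space.second_countable_if_compact_t1[OF assms(1)]
  by (simp add: Hausdorff_imp_t1_space metrizable_space_compact_Hausdorff_second_countable)

end
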